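(* Let $\mathcal{T}$ be a complete infinitely distributive lattice with a De Morgan complement, and let $P$ be an annotated revision program over a set of atoms $U$ with annotations in $\mathcal{T}$. A consistent $\mathcal{T}^2$-valuation $B$ is an s-model of $P$ if and only if $B$ is a model of $P$.
   Context: Lattice: $\mathcal{T}$ is a complete lattice with order $\le$, operations $\wedge,\vee$, satisfying both infinite distributive laws ($a\vee\bigwedge S=\bigwedge_{s\in S}(a\vee s)$ and $a\wedge\bigvee S=\bigvee_{s\in S}(a\wedge s)$), with a De Morgan complement $\alpha\mapsto\overline{\alpha}$ (an order-reversing involution). Programs: $U$ is a set of atoms. Revision atoms are the formal expressions $\mathbf{in}(a)$, $\mathbf{out}(a)$, $a\in U$. An annotated revision atom is $(l:\alpha)$ with $l$ a revision atom and $\alpha\in\mathcal{T}$. An annotated revision rule is $p\leftarrow q_1,\dots,q_n$ ($n\ge 0$) with $p$ (head) and $q_1,\dots,q_n$ (body) annotated revision atoms. An annotated revision program is a set of such rules. Valuations: $\mathcal{T}^2=\mathcal{T}\times\mathcal{T}$ is ordered by $\langle\alpha_1,\beta_1\rangle\le_k\langle\alpha_2,\beta_2\rangle$ iff $\alpha_1\le\alpha_2$ and $\beta_1\le\beta_2$; its meet and join are $\otimes,\oplus$. Conflation is $-\langle\alpha,\beta\rangle=\langle\overline{\beta},\overline{\alpha}\rangle$. A $\mathcal{T}^2$-valuation is a map $B:U\to\mathcal{T}^2$; $\le_k,\otimes,\oplus,-$ are extended pointwise. $B$ is consistent if $B\le_k -B$. If $B(a)=\langle\alpha,\beta\rangle$,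 write $B[\mathbf{in}(a)]=\alpha$, $B[\mathbf{out}(a)]=\beta$. $B$ satisfies $(l:\alpha)$ if $\alpha\le B[l]$, and satisfies a body if it satisfies each of its members. $B$ is a model of $P$ if, for every rule of $P$, $B$ satisfies the head whenever it satisfies the body. s-models: $T_P^b(B)$ is the $\mathcal{T}^2$-valuation with $T_P^b(B)[l]=\bigvee\{\alpha : (l:\alpha)$ is the head of a rule of $P$ whose body is satisfied by $B\}$ for each revision atom $l$. $B$ is an s-model of $P$ if $T_P^b(B)\le_k B\le_k T_P^b(B)\oplus(-T_P^b(B))$. *)

theory Defs
  imports "HOL-Library.Product_Order"
begin

(* The library class complete_distrib_lattice demands complete distributivity (over arbitrary
   choice functions), which is strictly stronger than the two infinite distributive laws. *)
class infinitely_distributive_lattice = complete_lattice +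
  assumes sup_Inf_distrib: "sup a (Inf S) = Inf ((\<lambda>s. sup a s) ` S)"
    and inf_Sup_distrib: "inf a (Sup S) = Sup ((\<lambda>s. inf a s) ` S)"

definition de_morgan_complement :: "('t::order \<Rightarrow> 't) \<Rightarrow> bool" where
  "de_morgan_complement cmp \<longleftrightarrow> antimono cmp \<and> (\<forall>\<alpha>. cmp (cmp \<alpha>) = \<alpha>)"

(* The set U of atoms is the type 'u. *)
datatype 'u revision_atom = In 'u | Out 'u

type_synonym ('u, 't) annotated_atom = "'u revision_atom \<times> 't"

datatype ('u, 't) rule =
  Rule (head: "('u, 't) annotated_atom") (body: "('u, 't) annotated_atom list")

type_synonym ('u, 't) program = "('u, 't) rule set"

(* The order \<le>_k and the join on T^2-valuations are the library's \<le> and sup on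
   'u \<Rightarrow> 't \<times> 't: componentwise on pairs (Product_Order), pointwise on functions. *)
type_synonym ('u, 't) valuation = "'u \<Rightarrow> 't \<times> 't"

definition conflation ::
    "('t \<Rightarrow> 't) \<Rightarrow> ('u, 't) valuation \<Rightarrow> ('u, 't) valuation" where
  "conflation cmp B = (\<lambda>a. (cmp (snd (B a)), cmp (fst (B a))))"

definition consistent :: "('t::ord \<Rightarrow> 't) \<Rightarrow> ('u, 't) valuation \<Rightarrow> bool" where
  "consistent cmp B \<longleftrightarrow> B \<le> conflation cmp B"

fun val :: "('u, 't) valuation \<Rightarrow> 'u revision_atom \<Rightarrow> 't" where
  "val B (In a) = fst (B a)"
| "val B (Out a) = snd (B a)"

fun satisfies :: "('u, 't::ord) valuation \<Rightarrow> ('u, 't) annotated_atom \<Rightarrow> bool" where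
  "satisfies B (l, \<alpha>) \<longleftrightarrow> \<alpha> \<le> val B l"

definition satisfies_body ::
    "('u, 't::ord) valuation \<Rightarrow> ('u, 't) annotated_atom list \<Rightarrow> bool" where
  "satisfies_body B qs \<longleftrightarrow> (\<forall>q\<in>set qs. satisfies B q)"

definition is_model :: "('u, 't::ord) program \<Rightarrow> ('u, 't) valuation \<Rightarrow> bool" where
  "is_model P B \<longleftrightarrow> (\<forall>r\<in>P. satisfies_body B (body r) \<longrightarrow> satisfies B (head r))"

definition derived_value ::
    "('u, 't::complete_lattice) program \<Rightarrow> ('u, 't) valuation \<Rightarrow> 'u revision_atom \<Rightarrow> 't" where
  "derived_value P B l = Sup {\<alpha>. \<exists>r\<in>P. head r = (l, \<alpha>) \<and> satisfies_body B (body r)}"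

(* T_P^b(B): the unique valuation with val (T_op P B) l = derived_value P B l for all l. *)
definition T_op ::
    "('u, 't::complete_lattice) program \<Rightarrow> ('u, 't) valuation \<Rightarrow> ('u, 't) valuation" where
  "T_op P B = (\<lambda>a. (derived_value P B (In a), derived_value P B (Out a)))"

definition s_model ::
    "('t::complete_lattice \<Rightarrow> 't) \<Rightarrow> ('u, 't) program \<Rightarrow> ('u, 't) valuation \<Rightarrow> bool" where
  "s_model cmp P B \<longleftrightarrow>
     T_op P B \<le> B \<and> B \<le> sup (T_op P B) (conflation cmp (T_op P B))"

end

(* Models are exactly the pre-fixpoints of the operator T_op P. As conflation is antitone,
   T_op P B \<le> B together with consistency gives B \<le> - B \<le> - T_op P B,
   so the second half of the definition of an s-model is automatic. *)
theory Submission
  imports Defs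
begin

text \<open>Turns the pointwise order on pairs into a condition on each revision atom, the form in
  which satisfaction is stated.\<close>

lemma valuation_le_iff: "B \<le> C \<longleftrightarrow> (\<forall>l. val B l \<le> val C l)"
proof
  show "\<forall>l. val B l \<le> val C l" if "B \<le> C"
  proof
    show "val B l \<le> val C l" for l
      using that by (cases l) (simp_all add: le_fun_def less_eq_prod_def)
  qed
  show "B \<le> C" if le: "\<forall>l. val B l \<le> val C l"
  proof (rule le_funI)
    show "B a \<le> C a" for a
      using le[rule_format, of "In a"] le[rule_format, of "Out a"]
      by (simp add: less_eq_prod_def)
  qed
qed

lemma val_T_op: "val (T_op P B) l = derived_value P B l"
  by (cases l) (simp_all add: T_op_def)

text \<open>A supremum lies below \<open>val B l\<close> iff each of its members does, and the
  members are the annotations of heads on \<open>l\<close> whose bodies \<open>B\<close>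
  satisfies.\<close>

lemma T_op_le_iff_is_model: "T_op P B \<le> B \<longleftrightarrow> is_model P B"
proof -
  have "T_op P B \<le> B \<longleftrightarrow>
      (\<forall>l \<alpha>. \<forall>r\<in>P. head r = (l, \<alpha>) \<longrightarrow> satisfies_body B (body r) \<longrightarrow> satisfies B (l, \<alpha>))"
    by (auto simp: valuation_le_iff val_T_op derived_value_def Sup_le_iff)
  also have "\<dots> \<longleftrightarrow> is_model P B"
    \<comment> \<open>Every head is some pair \<open>(l, \<alpha>)\<close>, so ranging over these
      pairs covers all rules.\<close>
    unfolding is_model_def by (metis prod.exhaust)
  finally show ?thesis .
qed

text \<open>Swapping the components preserves the order; \<open>cmp\<close> then reverses it in
  each.\<close>

lemma antimono_conflation:
  fixes cmp :: "'t::order \<Rightarrow> 't"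
  assumes "antimono cmp"
  shows "antimono (conflation cmp :: ('u, 't) valuation \<Rightarrow> _)"
proof (rule antimonoI)
  show "conflation cmp C \<le> conflation cmp B" if "B \<le> C" for B C :: "('u, 't) valuation"
    using that by (simp add: conflation_def le_fun_def less_eq_prod_def antimonoD[OF assms])
qed

theorem theorem3p4:
  fixes cmp :: "'t::infinitely_distributive_lattice \<Rightarrow> 't"
    and P :: "('u, 't) program"
    and B :: "('u, 't) valuation"
  assumes "de_morgan_complement cmp"
    and "consistent cmp B"
  shows "s_model cmp P B \<longleftrightarrow> is_model P B"
proof -
  have anti: "antimono (conflation cmp :: ('u, 't) valuation \<Rightarrow> _)"
    using assms(1) by (simp add: de_morgan_complement_def antimono_conflation)
  have "B \<le> sup (T_op P B) (conflation cmp (T_op P B))" if "T_op P B \<le> B"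
  proof -
    have "B \<le> conflation cmp B"
      using assms(2) by (simp add: consistent_def)
    also have "\<dots> \<le> conflation cmp (T_op P B)"
      using anti that by (rule antimonoD)
    finally show ?thesis
      by (rule le_supI2)
  qed
  \<comment> \<open>With \<open>is_model P B\<close> read as \<open>T_op P B \<le> B\<close>, it is
    the first conjunct of \<open>s_model\<close>, which implies the second.\<close>
  then show ?thesis
    unfolding s_model_def T_op_le_iff_is_model[symmetric] by blast
qed

end
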